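(* Let $p$ be a prime with $p\equiv 1\pmod{12}$. If $n=p+2$, then $D_n(1,x)$ is a complete permutation polynomial of $\mathbb{F}_p$.
   Context: The $n$th reversed Dickson polynomial of the first kind (with parameter $1$) is the integer-coefficient polynomial $D_n(1,x)$ defined by $D_0(1,x)=2$, $D_1(1,x)=1$, $D_n(1,x)=D_{n-1}(1,x)-x\,D_{n-2}(1,x)$ for $n\ge 2$. Coefficients are reduced modulo $p$ to regard it as a polynomial over $\mathbb{F}_p$. A polynomial $f$ is a permutation polynomial of $\mathbb{F}_p$ if the map it induces $\mathbb{F}_p\to\mathbb{F}_p$ is a bijection, and a complete permutation polynomial if both $f(x)$ and $f(x)+x$ are permutation polynomials of $\mathbb{F}_p$. *)

theory Defs
  imports "HOL-Computational_Algebra.Polynomial" "HOL-Computational_Algebra.Primes"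
    "HOL-Number_Theory.Cong"
begin

(* Reversed Dickson polynomials of the first kind D_n(1, x), over the integers. *)
fun reversed_dickson :: "nat \<Rightarrow> int poly" where
  "reversed_dickson 0 = 2"
| "reversed_dickson (Suc 0) = 1"
| "reversed_dickson (Suc (Suc n)) =
     reversed_dickson (Suc n) - [:0, 1:] * reversed_dickson n"

definition permutation_poly :: "'a::{field,finite} poly \<Rightarrow> bool" where
  "permutation_poly f \<longleftrightarrow> bij (poly f)"

definition complete_permutation_poly :: "'a::{field,finite} poly \<Rightarrow> bool" where
  "complete_permutation_poly f \<longleftrightarrow> permutation_poly f \<and> permutation_poly (f + [:0, 1:])"

end

theory Submission
  imports Defs "HOL-Number_Theory.Residues"
begin

text \<open>
  Writing \<open>x = y (1 - y)\<close> turns the recursion into that of power sums, so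
  \<open>D\<^sub>n(1, x) = y ^ n + (1 - y) ^ n\<close>.  Over a field of odd characteristic one can take
  \<open>y = (1 + u) / 2\<close>, with \<open>u\<close> a square root of \<open>w = 1 - 4 x\<close>, and for \<open>n = p + 2\<close> the
  Frobenius map \<open>(1 + u) ^ p = 1 + u ^ p\<close> leaves only
  \<open>D\<^sub>n(1, x) = (1 + w + 2 w ^ (m + 1)) / 4\<close>, where \<open>p = 2 m + 1\<close>
  (lemma \<open>poly_reversed_dickson_char_plus_2\<close>).  As \<open>x = (1 - w) / 4\<close>, also
  \<open>D\<^sub>n(1, x) + x = (1 + w ^ (m + 1)) / 2\<close>.

  Both maps are thus affine images of a map \<open>w \<mapsto> w (a + b w ^ m)\<close>.  Since \<open>w ^ m\<close> is the
  quadratic character of \<open>w\<close>, such a map multiplies the nonzero squares by \<open>a + b\<close> and the nonsquares by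
  \<open>a - b\<close>; if these two factors are nonzero squares, then the map preserves the quadratic
  character and is injective (lemma \<open>inj_times_affine_quadratic_character\<close>).  The factors are
  \<open>3\<close> and \<open>-1\<close> for \<open>D\<^sub>n\<close>, and \<open>1\<close> and \<open>-1\<close> for \<open>D\<^sub>n + x\<close>.  The number \<open>-1\<close> is a square because
  \<open>p \<equiv> 1\<close> modulo \<open>4\<close>, and \<open>3\<close> is one because in addition \<open>p \<equiv> 1\<close> modulo \<open>3\<close>.
\<close>

section \<open>Reversed Dickson polynomials as power sums\<close>

lemma map_poly_of_int_reversed_dickson_Suc_Suc:
  "(map_poly of_int (reversed_dickson (Suc (Suc n))) :: 'a::comm_ring_1 poly) =
     map_poly of_int (reversed_dickson (Suc n)) - [:0, 1:] * map_poly of_int (reversed_dickson n)"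
  by (rule poly_eqI) (simp add: coeff_map_poly coeff_pCons split: nat.split)

text \<open>
  The elements \<open>y\<close> and \<open>1 - y\<close> have sum \<open>1\<close> and product \<open>y (1 - y)\<close>, so their power sums
  satisfy the recursion of \<open>D\<^sub>n(1, y (1 - y))\<close>.
\<close>

lemma pcompose_reversed_dickson:
  fixes y :: "'a::comm_ring_1 poly"
  shows "pcompose (map_poly of_int (reversed_dickson n)) (y * (1 - y)) = y ^ n + (1 - y) ^ n"
proof (induction n rule: reversed_dickson.induct)
  case 1
  have "(map_poly of_int 2 :: 'a poly) = 2"
    by (rule poly_eqI) (simp add: coeff_map_poly numeral_poly coeff_pCons split: nat.split)
  then show ?case
    by (simp add: numeral_poly)
next
  case 2
  show ?case
    by (simp add: pcompose_1)
next
  case (3 n)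
  have "pcompose (map_poly of_int (reversed_dickson (Suc (Suc n)))) (y * (1 - y)) =
      y ^ Suc n + (1 - y) ^ Suc n - y * (1 - y) * (y ^ n + (1 - y) ^ n)"
    unfolding map_poly_of_int_reversed_dickson_Suc_Suc pcompose_diff pcompose_mult 3
    by (simp add: pcompose_pCons)
  also have "\<dots> = y ^ Suc (Suc n) + (1 - y) ^ Suc (Suc n)"
    by (simp add: algebra_simps)
  finally show ?case .
qed

text \<open>
  Since \<open>w\<close> need not have a square root \<open>u\<close> in the field, the computation with \<open>y = (1 + u) / 2\<close>
  takes place in the polynomial ring, with \<open>u\<close> the indeterminate.  It yields an identity between
  polynomials in \<open>u\<^sup>2\<close>, in which \<open>u\<^sup>2\<close> may then be replaced by any \<open>w\<close>.
\<close>

lemma poly_reversed_dickson_char_plus_2: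
  fixes w :: "'a::field"
  assumes char: "CHAR('a) = 2 * m + 1" and prime: "prime CHAR('a)"
  shows "4 * poly (map_poly of_int (reversed_dickson (CHAR('a) + 2))) ((1 - w) / 4) =
    1 + w + 2 * w ^ Suc m"
proof -
  define D :: "'a poly" where "D = map_poly of_int (reversed_dickson (CHAR('a) + 2))"
  define U :: "'a poly" where "U = [:0, 1:]"
  define h :: 'a where "h = inverse 2"
  have two: "(2::'a) \<noteq> 0"
  proof
    assume "(2::'a) = 0"
    then have "CHAR('a) dvd 2"
      using of_nat_eq_0_iff_char_dvd[where ?'a = 'a, of 2] by simp
    then show False
      using prime char
      by (metis dvd_refl even_plus_one_iff even_mult_iff primes_dvd_imp_eq two_is_prime_nat)
  qed
  have four: "(4::'a) \<noteq> 0"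
    using two by (metis mult_2 mult_eq_0_iff numeral_Bit0)
  have h2: "h * 2 = 1" "h ^ 2 * 4 = 1"
    using two four by (simp_all add: h_def power2_eq_square field_simps)
  have frob2: "(2::'a) ^ CHAR('a) = 2"
    using freshmans_dream[where ?'a = 'a, OF prime refl, of 1 1] by simp
  have "h ^ CHAR('a) = h"
    unfolding h_def power_inverse frob2 ..
  then have hp: "h ^ (CHAR('a) + 2) = h ^ 3"
    by (simp add: power_add power3_eq_cube power2_eq_square)
  define y where "y = Polynomial.smult h (1 + U)"
  have y1: "1 - y = Polynomial.smult h (1 - U)"
  proof -
    have "1 - h = h"
      using h2 by (simp add: algebra_simps)
    then show ?thesis
      by (simp add: y_def U_def one_pCons)
  qed
  define G where "G = Polynomial.smult (h ^ 2) (1 + U + 2 * U ^ Suc m)"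
  have frob: "(1 + V) ^ CHAR('a) = 1 + V ^ CHAR('a)" for V :: "'a poly"
    by (subst freshmans_dream) (use prime in simp_all)
  have prod: "y * (1 - y) = pcompose [:h ^ 2, - (h ^ 2):] (U ^ 2)"
    unfolding y1 by (simp add: y_def U_def pcompose_pCons power2_eq_square one_pCons)
  \<comment> \<open>As a polynomial in \<open>U\<close>, \<open>y (1 - y)\<close> is \<open>(1 - U\<^sup>2) / 4\<close>; odd powers of \<open>U\<close> cancel in the sum below.\<close>
  have "pcompose (pcompose D [:h ^ 2, - (h ^ 2):]) (U ^ 2) =
      y ^ (CHAR('a) + 2) + (1 - y) ^ (CHAR('a) + 2)"
    using pcompose_reversed_dickson[of "CHAR('a) + 2" y]
    by (simp only: prod D_def pcompose_assoc)
  also have "\<dots> = Polynomial.smult (h ^ 3)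
      ((1 + U ^ CHAR('a)) * (1 + U) ^ 2 + (1 - U ^ CHAR('a)) * (1 - U) ^ 2)"
  proof -
    have "Polynomial.smult h (1 + V) ^ (CHAR('a) + 2) =
        Polynomial.smult (h ^ 3) ((1 + V ^ CHAR('a)) * (1 + V) ^ 2)" for V :: "'a poly"
      by (simp only: smult_power hp) (simp only: power_add frob)
    from this[of U] this[of "- U"] show ?thesis
      unfolding y1 by (simp add: y_def char smult_add_right)
  qed
  also have "\<dots> = Polynomial.smult (h ^ 3) (2 * (1 + U ^ 2 + 2 * (U ^ 2) ^ Suc m))"
  proof -
    have "U ^ CHAR('a) * U = (U ^ 2) ^ Suc m"
      by (simp add: char power2_eq_square power_mult_distrib mult_2 power_add)
    moreover have "(1 + V) * (1 + U) ^ 2 + (1 - V) * (1 - U) ^ 2 = 2 * (1 + U ^ 2 + 2 * (V * U))"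
      for V
      by (simp add: power2_eq_square algebra_simps)
    ultimately show ?thesis
      by simp
  qed
  also have "\<dots> = Polynomial.smult (h ^ 3 * 2) (1 + U ^ 2 + 2 * (U ^ 2) ^ Suc m)"
    by (simp add: numeral_poly)
  also have "h ^ 3 * 2 = h ^ 2"
    using h2 by (simp add: power3_eq_cube power2_eq_square)
  also have "Polynomial.smult (h ^ 2) (1 + U ^ 2 + 2 * (U ^ 2) ^ Suc m) =
      pcompose G (U ^ 2)"
  proof -
    have "pcompose (U ^ k) (U ^ 2) = (U ^ 2) ^ k" for k
      by (induction k) (simp_all add: pcompose_mult pcompose_1, simp add: U_def pcompose_pCons)
    from this[of "Suc m"] this[of 1] show ?thesis
      by (simp only: G_def pcompose_smult pcompose_add pcompose_mult pcompose_1 numeral_poly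
          pcompose_const power_one_right)
  qed
  finally have "pcompose (pcompose D [:h ^ 2, - (h ^ 2):] - G) (U ^ 2) = 0"
    by (simp add: pcompose_diff)
  moreover have "degree (U ^ 2) > 0"
    by (simp add: U_def power2_eq_square)
  ultimately have "pcompose D [:h ^ 2, - (h ^ 2):] - G = 0"
    by (rule pcompose_eq_0)
  then have "poly (pcompose D [:h ^ 2, - (h ^ 2):]) w = poly G w"
    by simp
  then have "poly D (h ^ 2 - w * h ^ 2) = h ^ 2 * (1 + w + 2 * w ^ Suc m)"
    by (simp add: poly_pcompose G_def U_def)
  moreover have "h ^ 2 = 1 / 4"
    using h2 four by (simp add: field_simps)
  ultimately show ?thesis
    using four unfolding D_def[symmetric] by (simp add: diff_divide_distrib mult.commute)
qed

section \<open>Squares in a finite field\<close>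

text \<open>Multiplication by \<open>x\<close> permutes the nonzero elements, hence preserves their product.\<close>

lemma finite_field_power_card_minus_one:
  fixes x :: "'a::{field,finite}"
  assumes "x \<noteq> 0"
  shows "x ^ (card (UNIV :: 'a set) - 1) = 1"
proof -
  let ?S = "UNIV - {0::'a}"
  have "bij_betw ((*) x) ?S ?S"
    by (rule bij_betwI[where g = "\<lambda>y. y / x"]) (use assms in auto)
  then have "(\<Prod>y\<in>?S. x * y) = \<Prod>?S"
    by (rule prod.reindex_bij_betw)
  then have "x ^ card ?S * \<Prod>?S = \<Prod>?S"
    by (simp add: prod.distrib)
  moreover have "\<Prod>?S \<noteq> 0"
    by simp
  ultimately show ?thesis
    by (simp add: card_Diff_singleton)
qed

text \<open>
  The map keeps the value of \<open>w ^ m\<close>, by the hypotheses on \<open>a + b\<close> and \<open>a - b\<close>; on each fibre of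
  \<open>w ^ m\<close> it is multiplication by a constant.
\<close>

lemma inj_times_affine_quadratic_character:
  fixes a b :: "'a::{field,finite}"
  assumes card: "card (UNIV :: 'a set) = 2 * m + 1" and "m > 0"
    and plus: "(a + b) ^ m = 1" and minus: "(a - b) ^ m = 1"
  shows "inj (\<lambda>w. w * (a + b * w ^ m))"
proof (rule injI)
  let ?f = "\<lambda>w. w * (a + b * w ^ m)"
  fix v w :: 'a
  assume eq: "?f v = ?f w"
  have char: "w ^ m = 0 \<or> w ^ m = 1 \<or> w ^ m = - 1" for w :: 'a
  proof (cases "w = 0")
    case True
    then show ?thesis
      using \<open>m > 0\<close> by simp
  next
    case False
    then have "(w ^ m) ^ 2 = 1"
      using finite_field_power_card_minus_one[of w] card by (simp flip: power_mult add: mult.commute)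
    then show ?thesis
      by (simp add: power2_eq_1_iff)
  qed
  have keep: "?f w ^ m = w ^ m" for w
    using char[of w] plus minus \<open>m > 0\<close> by (auto simp: power_mult_distrib)
  have same: "v ^ m = w ^ m"
    using eq keep by metis
  show "v = w"
  proof (cases "w ^ m = 0")
    case True
    with same have "v ^ m = 0"
      by simp
    with True show ?thesis
      by simp
  next
    case False
    have "a + b * w ^ m \<noteq> 0"
      using char[of w] False plus minus \<open>m > 0\<close> by (auto simp: zero_power)
    then show ?thesis
      using eq by (simp add: same)
  qed
qed

text \<open>
  A cube root of unity \<open>\<omega> \<noteq> 1\<close> satisfies \<open>(2 \<omega> + 1)\<^sup>2 = -3\<close>.  It exists as a power
  \<open>g ^ k\<close>, where \<open>3 k\<close> is the order of the multiplicative group, since the polynomial \<open>X ^ k - 1\<close>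
  has at most \<open>k\<close> roots.
\<close>

lemma neg_three_square:
  assumes card: "card (UNIV :: 'a set) = 3 * k + 1"
  obtains s :: "'a::{field,finite}" where "s ^ 2 = - 3"
proof -
  have "k > 0"
    using card card_mono[of "UNIV :: 'a set" "{0, 1}"] by (cases k) auto
  have "\<exists>g::'a. g \<noteq> 0 \<and> g ^ k \<noteq> 1"
  proof (rule ccontr)
    assume "\<not> ?thesis"
    then have sub: "UNIV - {0} \<subseteq> {x::'a. x ^ k = 1}"
      by auto
    define q :: "'a poly" where "q = Polynomial.monom 1 k - 1"
    have "card (UNIV - {0::'a}) \<le> card {x. poly q x = 0}"
      using sub by (intro card_mono) (simp_all add: q_def poly_monom)
    also have "\<dots> \<le> degree q"
      by (rule card_poly_roots_bound) (use \<open>k > 0\<close> in \<open>simp add: q_def monom_eq_1_iff\<close>)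
    also have "\<dots> \<le> k"
      unfolding q_def by (rule degree_diff_le) (simp_all add: degree_monom_le)
    finally show False
      using card \<open>k > 0\<close> by (simp add: card_Diff_singleton)
  qed
  then obtain g :: 'a where g: "g \<noteq> 0" "g ^ k \<noteq> 1"
    by blast
  define t where "t = g ^ k"
  have "t ^ 3 = 1"
    using finite_field_power_card_minus_one[OF g(1)] card
    by (simp add: t_def flip: power_mult add: mult.commute)
  then have "(t - 1) * (t ^ 2 + t + 1) = 0"
    by (simp add: algebra_simps power2_eq_square power3_eq_cube)
  then have "t ^ 2 + t + 1 = 0"
    using g(2) by (simp add: t_def)
  moreover have "(2 * t + 1) ^ 2 = 4 * (t ^ 2 + t + 1) - 3"
    by (simp add: algebra_simps power2_eq_square)
  ultimately have "(2 * t + 1) ^ 2 = - 3"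
    by simp
  then show thesis
    by (rule that)
qed

section \<open>Complete permutation polynomials\<close>

theorem proposition3p36:
  fixes p n :: nat
  assumes "prime p"
    and "card (UNIV :: 'a::{field,finite} set) = p"
    and "[p = 1] (mod 12)"
    and "n = p + 2"
  shows "complete_permutation_poly (map_poly of_int (reversed_dickson n) :: 'a poly)"
proof -
  define D :: "'a poly" where "D = map_poly of_int (reversed_dickson n)"
  from \<open>[p = 1] (mod 12)\<close> have "p mod 12 = 1"
    by (simp add: cong_def)
  then obtain j where p: "p = 12 * j + 1"
    by (metis mult_div_mod_eq)
  have "j > 0"
    using p \<open>prime p\<close> by (cases j) auto
  define m where "m = 6 * j"
  have m: "p = 2 * m + 1" "m > 0" "even m"
    using p \<open>j > 0\<close> by (simp_all add: m_def)
  have char: "CHAR('a) = p"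
  proof -
    have "CHAR('a) dvd p"
      using CHAR_dvd_CARD[where ?'a = 'a] assms(2) by simp
    then show ?thesis
      using \<open>prime p\<close> CHAR_not_1'[where ?'a = 'a] by (auto simp: prime_nat_iff)
  qed
  have small: "of_nat k \<noteq> (0::'a)" if "0 < k" "k < 12" for k
    using that p \<open>j > 0\<close> by (auto simp: of_nat_eq_0_iff_char_dvd char dest: dvd_imp_le)
  have nz: "(2::'a) \<noteq> 0" "(3::'a) \<noteq> 0" "(4::'a) \<noteq> 0"
    using small[of 2] small[of 3] small[of 4] by simp_all
  have fermat: "x ^ (2 * m) = 1" if "x \<noteq> 0" for x :: 'a
    using finite_field_power_card_minus_one[OF that] assms(2) m by simp
  have D: "4 * poly D ((1 - w) / 4) = 1 + w + 2 * w ^ Suc m" for w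
    using poly_reversed_dickson_char_plus_2[where ?'a = 'a, of m w] m \<open>prime p\<close> \<open>n = p + 2\<close> char
    by (simp add: D_def)
  \<comment> \<open>As \<open>m\<close> is even, \<open>3\<close> and \<open>-3\<close> have the same quadratic character.\<close>
  have three: "(3::'a) ^ m = 1"
  proof -
    obtain s :: 'a where s: "s ^ 2 = - 3"
      using neg_three_square[where ?'a = 'a, of "4 * j"] assms(2) p by auto
    then have "s \<noteq> 0"
      using nz by auto
    have "(3::'a) ^ m = (- (s ^ 2)) ^ m"
      using s by simp
    also have "\<dots> = s ^ (2 * m)"
      using m(3) by (simp add: power_mult)
    finally show ?thesis
      using fermat[OF \<open>s \<noteq> 0\<close>] by simp
  qed
  have w: "x = (1 - (1 - 4 * x)) / 4" for x :: 'a
    using nz by simp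
  have perm: "permutation_poly f"
    if f: "\<And>w. c * poly f ((1 - w) / 4) = 1 + w * (a + b * w ^ m)"
      and "(a + b) ^ m = 1" "(a - b) ^ m = 1" for f :: "'a poly" and a b c
  proof -
    have "inj (poly f)"
    proof (rule injI)
      fix x y
      assume "poly f x = poly f y"
      then have "(1 - 4 * x) * (a + b * (1 - 4 * x) ^ m) = (1 - 4 * y) * (a + b * (1 - 4 * y) ^ m)"
        using f[of "1 - 4 * x"] f[of "1 - 4 * y"] w by simp
      then have "1 - 4 * x = 1 - 4 * y"
        using inj_times_affine_quadratic_character[of m a b] that m assms(2)
        by (auto dest: injD)
      then show "x = y"
        using nz by simp
    qed
    then show ?thesis
      unfolding permutation_poly_def bij_def by (simp add: finite_UNIV_inj_surj)
  qed
  have "permutation_poly D"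
  proof (rule perm)
    show "4 * poly D ((1 - w) / 4) = 1 + w * (1 + 2 * w ^ m)" for w
      using D[of w] by (simp add: algebra_simps)
  qed (use nz three m in simp_all)
  moreover have "permutation_poly (D + [:0, 1:])"
  proof (rule perm)
    fix w :: 'a
    have "2 * (2 * poly (D + [:0, 1:]) ((1 - w) / 4)) = 4 * poly D ((1 - w) / 4) + (1 - w)"
      using nz by simp
    also have "\<dots> = 2 * (1 + w * (0 + 1 * w ^ m))"
      unfolding D by (simp add: algebra_simps)
    finally show "2 * poly (D + [:0, 1:]) ((1 - w) / 4) = 1 + w * (0 + 1 * w ^ m)"
      using nz(1) mult_left_cancel by blast
  qed (use nz m in simp_all)
  ultimately show ?thesis
    by (simp add: complete_permutation_poly_def D_def)
qed

end
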